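(* Let $L,U\in\mathbb{R}^\eta$, $[L,U]=\{x\in\mathbb{R}^\eta:L_i\le x_i\le U_i\ \forall i\}$, $w^1,\dots,w^d\in\mathbb{R}^\eta$ and $b^1,\dots,b^d\in\mathbb{R}$. Consider the family of inequalities $$y\le\sum_{i=1}^\eta\left(w^{I(i)}_ix_i+\sum_{k=1}^d\max\{(w^k_i-w^{I(i)}_i)L_i,(w^k_i-w^{I(i)}_i)U_i\}z_k\right)+\sum_{k=1}^db^kz_k$$ indexed by all mappings $I:\{1,\dots,\eta\}\to\{1,\dots,d\}$. Take some point $(\hat x,\hat y,\hat z)\in[L,U]\times\mathbb{R}\times\Delta^d$. If any constraint in the family is violated at the given point, a most-violated constraint can be constructed by selecting $\hat I:\{1,\dots,\eta\}\to\{1,\dots,d\}$ such that, for each $i\in\{1,\dots,\eta\}$, $$\hat I(i)\in\arg\min_{\ell\in\{1,\dots,d\}}\left(w^\ell_i\hat x_i+\sum_{k=1}^d\max\{(w^k_i-w^\ell_i)L_i,(w^k_i-w^\ell_i)U_i\}\hat z_k\right).$$ Moreover, if the weights $w^k_i$ are sorted on $k$ for each $i\in\{1,\dots,\eta\}$, this can be done in $\mathcal{O}(\eta d)$ time.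
   Context: $\Delta^d=\{z\in\mathbb{R}^d_{\ge0}:\sum_k z_k=1\}$. *)

theory Defs
  imports Complex_Main "HOL-Library.FuncSet"
begin

section \<open>The family of inequalities\<close>

text \<open>
  The dimensions vary inside the statement (the running time is uniform in them), so a vector
  of length \<open>n\<close> is a function on \<open>nat\<close> that is only ever read at the indices \<open>{1..n}\<close>.
  The component \<open>w\<^sup>k\<^sub>i\<close> is written \<open>w k i\<close>.
\<close>

definition box :: "nat \<Rightarrow> (nat \<Rightarrow> real) \<Rightarrow> (nat \<Rightarrow> real) \<Rightarrow> (nat \<Rightarrow> real) set" where
  "box \<eta> L U = {x. \<forall>i\<in>{1..\<eta>}. L i \<le> x i \<and> x i \<le> U i}"

definition simplex :: "nat \<Rightarrow> (nat \<Rightarrow> real) set" where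
  "simplex d = {z. (\<forall>k\<in>{1..d}. 0 \<le> z k) \<and> (\<Sum>k=1..d. z k) = 1}"

definition mappings :: "nat \<Rightarrow> nat \<Rightarrow> (nat \<Rightarrow> nat) set" where
  "mappings \<eta> d = {1..\<eta>} \<rightarrow>\<^sub>E {1..d}"

definition family_rhs ::
  "nat \<Rightarrow> nat \<Rightarrow> (nat \<Rightarrow> nat \<Rightarrow> real) \<Rightarrow> (nat \<Rightarrow> real) \<Rightarrow> (nat \<Rightarrow> real) \<Rightarrow> (nat \<Rightarrow> real)
    \<Rightarrow> (nat \<Rightarrow> nat) \<Rightarrow> (nat \<Rightarrow> real) \<Rightarrow> (nat \<Rightarrow> real) \<Rightarrow> real" where
  "family_rhs \<eta> d w b L U I x z =
     (\<Sum>i=1..\<eta>. w (I i) i * x i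
        + (\<Sum>k=1..d. max ((w k i - w (I i) i) * L i) ((w k i - w (I i) i) * U i) * z k))
     + (\<Sum>k=1..d. b k * z k)"

definition violated ::
  "nat \<Rightarrow> nat \<Rightarrow> (nat \<Rightarrow> nat \<Rightarrow> real) \<Rightarrow> (nat \<Rightarrow> real) \<Rightarrow> (nat \<Rightarrow> real) \<Rightarrow> (nat \<Rightarrow> real)
    \<Rightarrow> (nat \<Rightarrow> real) \<Rightarrow> real \<Rightarrow> (nat \<Rightarrow> real) \<Rightarrow> (nat \<Rightarrow> nat) \<Rightarrow> bool" where
  "violated \<eta> d w b L U x y z I \<longleftrightarrow> \<not> y \<le> family_rhs \<eta> d w b L U I x z"

text \<open>Violation is the absolute amount by which an inequality fails, left side minus right side.\<close>

definition most_violated ::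
  "nat \<Rightarrow> nat \<Rightarrow> (nat \<Rightarrow> nat \<Rightarrow> real) \<Rightarrow> (nat \<Rightarrow> real) \<Rightarrow> (nat \<Rightarrow> real) \<Rightarrow> (nat \<Rightarrow> real)
    \<Rightarrow> (nat \<Rightarrow> real) \<Rightarrow> real \<Rightarrow> (nat \<Rightarrow> real) \<Rightarrow> (nat \<Rightarrow> nat) \<Rightarrow> bool" where
  "most_violated \<eta> d w b L U x y z I \<longleftrightarrow>
     I \<in> mappings \<eta> d \<and> violated \<eta> d w b L U x y z I \<and>
     (\<forall>J\<in>mappings \<eta> d.
        y - family_rhs \<eta> d w b L U J x z \<le> y - family_rhs \<eta> d w b L U I x z)"

definition selections ::
  "nat \<Rightarrow> nat \<Rightarrow> (nat \<Rightarrow> nat \<Rightarrow> real) \<Rightarrow> (nat \<Rightarrow> real) \<Rightarrow> (nat \<Rightarrow> real)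
    \<Rightarrow> (nat \<Rightarrow> real) \<Rightarrow> (nat \<Rightarrow> real) \<Rightarrow> (nat \<Rightarrow> nat) set" where
  "selections \<eta> d w L U x z =
     {I \<in> mappings \<eta> d. \<forall>i\<in>{1..\<eta>}.
        is_arg_min
          (\<lambda>l. w l i * x i
             + (\<Sum>k=1..d. max ((w k i - w l i) * L i) ((w k i - w l i) * U i) * z k))
          (\<lambda>l. l \<in> {1..d}) (I i)}"


section \<open>A unit-cost real random-access machine\<close>

text \<open>
  Programs are while programs over natural-number and real registers and one-dimensional arrays
  of naturals and reals.  Every operation, register or memory access, constant and executed
  branch or loop test costs one step.  The operations form a subset of those of the usual
  real RAM: naturals, which serve as addresses, can only be added, (truncatedly) subtracted and
  compared; reals can be added, subtracted, multiplied and compared but not rounded; constants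
  are integers.
\<close>

type_synonym name = string

record state =
  nreg :: "name \<Rightarrow> nat"
  narr :: "name \<Rightarrow> nat \<Rightarrow> nat"
  rreg :: "name \<Rightarrow> real"
  rarr :: "name \<Rightarrow> nat \<Rightarrow> real"

datatype nexp =
    NConst nat
  | NReg name
  | NGet name nexp
  | NAdd nexp nexp
  | NSub nexp nexp

datatype rexp =
    RConst int
  | RReg name
  | RGet name nexp
  | RAdd rexp rexp
  | RSub rexp rexp
  | RMul rexp rexp

datatype bexp =
    NLess nexp nexp
  | RLess rexp rexp
  | BNot bexp
  | BAnd bexp bexp

datatype com =
    Skip
  | NSet name nexp
  | NPut name nexp nexp
  | RSet name rexp
  | RPut name nexp rexp
  | Seq com com
  | Cond bexp com com
  | While bexp com

primrec nval :: "nexp \<Rightarrow> state \<Rightarrow> nat" where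
  "nval (NConst n) s = n"
| "nval (NReg v) s = nreg s v"
| "nval (NGet a e) s = narr s a (nval e s)"
| "nval (NAdd e f) s = nval e s + nval f s"
| "nval (NSub e f) s = nval e s - nval f s"

primrec rval :: "rexp \<Rightarrow> state \<Rightarrow> real" where
  "rval (RConst c) s = real_of_int c"
| "rval (RReg v) s = rreg s v"
| "rval (RGet a e) s = rarr s a (nval e s)"
| "rval (RAdd e f) s = rval e s + rval f s"
| "rval (RSub e f) s = rval e s - rval f s"
| "rval (RMul e f) s = rval e s * rval f s"

primrec bval :: "bexp \<Rightarrow> state \<Rightarrow> bool" where
  "bval (NLess e f) s \<longleftrightarrow> nval e s < nval f s"
| "bval (RLess e f) s \<longleftrightarrow> rval e s < rval f s"
| "bval (BNot p) s \<longleftrightarrow> \<not> bval p s"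
| "bval (BAnd p q) s \<longleftrightarrow> bval p s \<and> bval q s"

primrec ncost :: "nexp \<Rightarrow> nat" where
  "ncost (NConst n) = 1"
| "ncost (NReg v) = 1"
| "ncost (NGet a e) = 1 + ncost e"
| "ncost (NAdd e f) = 1 + ncost e + ncost f"
| "ncost (NSub e f) = 1 + ncost e + ncost f"

primrec rcost :: "rexp \<Rightarrow> nat" where
  "rcost (RConst c) = 1"
| "rcost (RReg v) = 1"
| "rcost (RGet a e) = 1 + ncost e"
| "rcost (RAdd e f) = 1 + rcost e + rcost f"
| "rcost (RSub e f) = 1 + rcost e + rcost f"
| "rcost (RMul e f) = 1 + rcost e + rcost f"

primrec bcost :: "bexp \<Rightarrow> nat" where
  "bcost (NLess e f) = 1 + ncost e + ncost f"
| "bcost (RLess e f) = 1 + rcost e + rcost f"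
| "bcost (BNot p) = 1 + bcost p"
| "bcost (BAnd p q) = 1 + bcost p + bcost q"

text \<open>\<open>exec c s t s'\<close>: started in \<open>s\<close>, the program \<open>c\<close> halts in \<open>s'\<close> after exactly \<open>t\<close> steps.\<close>

inductive exec :: "com \<Rightarrow> state \<Rightarrow> nat \<Rightarrow> state \<Rightarrow> bool" where
  Skip: "exec Skip s 1 s"
| NSet: "exec (NSet v e) s (1 + ncost e) (s\<lparr>nreg := (nreg s)(v := nval e s)\<rparr>)"
| NPut: "exec (NPut a j e) s (1 + ncost j + ncost e)
    (s\<lparr>narr := (narr s)(a := (narr s a)(nval j s := nval e s))\<rparr>)"
| RSet: "exec (RSet v e) s (1 + rcost e) (s\<lparr>rreg := (rreg s)(v := rval e s)\<rparr>)"
| RPut: "exec (RPut a j e) s (1 + ncost j + rcost e)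
    (s\<lparr>rarr := (rarr s)(a := (rarr s a)(nval j s := rval e s))\<rparr>)"
| Seq: "exec c1 s t1 s1 \<Longrightarrow> exec c2 s1 t2 s2 \<Longrightarrow> exec (Seq c1 c2) s (t1 + t2) s2"
| CondTrue: "bval p s \<Longrightarrow> exec c1 s t s1 \<Longrightarrow> exec (Cond p c1 c2) s (1 + bcost p + t) s1"
| CondFalse: "\<not> bval p s \<Longrightarrow> exec c2 s t s1 \<Longrightarrow> exec (Cond p c1 c2) s (1 + bcost p + t) s1"
| WhileFalse: "\<not> bval p s \<Longrightarrow> exec (While p c) s (1 + bcost p) s"
| WhileTrue: "bval p s \<Longrightarrow> exec c s t1 s1 \<Longrightarrow> exec (While p c) s1 t2 s2
    \<Longrightarrow> exec (While p c) s (1 + bcost p + t1 + t2) s2"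

text \<open>
  Matrices are stored row by row: row \<open>i \<in> {1..\<eta>}\<close> occupies the cells \<open>i * d + 1, ..., i * d + d\<close>.
  Registers and cells not mentioned have arbitrary contents, so a program cannot rely on them.
\<close>

definition encodes ::
  "nat \<Rightarrow> nat \<Rightarrow> (nat \<Rightarrow> nat \<Rightarrow> real) \<Rightarrow> (nat \<Rightarrow> real) \<Rightarrow> (nat \<Rightarrow> real) \<Rightarrow> (nat \<Rightarrow> real)
    \<Rightarrow> (nat \<Rightarrow> real) \<Rightarrow> real \<Rightarrow> (nat \<Rightarrow> real) \<Rightarrow> state \<Rightarrow> bool" where
  "encodes \<eta> d w b L U x y z s \<longleftrightarrow>
     nreg s ''eta'' = \<eta> \<and> nreg s ''d'' = d \<and> rreg s ''y'' = y \<and>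
     (\<forall>i\<in>{1..\<eta>}. rarr s ''L'' i = L i \<and> rarr s ''U'' i = U i \<and> rarr s ''x'' i = x i) \<and>
     (\<forall>k\<in>{1..d}. rarr s ''b'' k = b k \<and> rarr s ''z'' k = z k) \<and>
     (\<forall>i\<in>{1..\<eta>}. \<forall>k\<in>{1..d}. rarr s ''w'' (i * d + k) = w k i)"

definition encodes_orders :: "nat \<Rightarrow> nat \<Rightarrow> (nat \<Rightarrow> nat \<Rightarrow> nat) \<Rightarrow> state \<Rightarrow> bool" where
  "encodes_orders \<eta> d \<sigma> s \<longleftrightarrow> (\<forall>i\<in>{1..\<eta>}. \<forall>j\<in>{1..d}. narr s ''sigma'' (i * d + j) = \<sigma> i j)"

definition output_mapping :: "nat \<Rightarrow> state \<Rightarrow> nat \<Rightarrow> nat" where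
  "output_mapping \<eta> s = restrict (narr s ''I'') {1..\<eta>}"

end

theory Submission
  imports Defs
begin

text \<open>
  The right-hand side separates over the rows \<open>i\<close>, so minimising every row term minimises the
  whole.  Fix a row, drop the index \<open>i\<close>, and reindex so that \<open>w\<^sup>1 \<le> \<dots> \<le> w\<^sup>d\<close>.  For all
  \<open>s\<^sub>1, \<dots>, s\<^sub>d \<in> [L, U]\<close> with \<open>\<Sum>\<^sub>k s\<^sub>k z\<^sub>k = x\<close> the row term is at least
  \<open>t x + \<Sum>\<^sub>k (w\<^sup>k - t) s\<^sub>k z\<^sub>k = \<Sum>\<^sub>k w\<^sup>k s\<^sub>k z\<^sub>k\<close>, whatever \<open>t\<close> is.  Equality holds at \<open>t = w\<^sup>J\<close> if
  \<open>s\<^sub>k = L\<close> for \<open>k < J\<close> and \<open>s\<^sub>k = U\<close> for \<open>k > J\<close>, and such an \<open>s\<close> exists for the first \<open>J\<close> with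
  \<open>x + (U - L) (z\<^sub>1 + \<dots> + z\<^sub>J) \<ge> U\<close>.  Finding this \<open>J\<close> is a single scan over the prefix sums of \<open>z\<close>.
\<close>

section \<open>Minimising a row\<close>

definition row_term ::
  "nat \<Rightarrow> (nat \<Rightarrow> nat \<Rightarrow> real) \<Rightarrow> (nat \<Rightarrow> real) \<Rightarrow> (nat \<Rightarrow> real)
    \<Rightarrow> (nat \<Rightarrow> real) \<Rightarrow> (nat \<Rightarrow> real) \<Rightarrow> nat \<Rightarrow> nat \<Rightarrow> real" where
  "row_term d w L U x z i l =
     w l i * x i + (\<Sum>k=1..d. max ((w k i - w l i) * L i) ((w k i - w l i) * U i) * z k)"

lemma family_rhs_row_term:
  "family_rhs \<eta> d w b L U I x z =
     (\<Sum>i=1..\<eta>. row_term d w L U x z i (I i)) + (\<Sum>k=1..d. b k * z k)"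
  by (simp add: family_rhs_def row_term_def)

lemma mem_selections_iff:
  "I \<in> selections \<eta> d w L U x z \<longleftrightarrow> I \<in> mappings \<eta> d \<and>
     (\<forall>i\<in>{1..\<eta>}. \<forall>l\<in>{1..d}. row_term d w L U x z i (I i) \<le> row_term d w L U x z i l)"
  by (fastforce simp: selections_def is_arg_min_linorder row_term_def mappings_def)

text \<open>For \<open>d = 0\<close> the coordinate sum is empty, hence 0 and not 1.\<close>

lemma simplex_dim_pos: "z \<in> simplex d \<Longrightarrow> 1 \<le> d"
  by (cases d) (auto simp: simplex_def)

lemma selections_nonempty:
  assumes "1 \<le> d"
  shows "selections \<eta> d w L U x z \<noteq> {}"
proof -
  have "\<exists>m\<in>{1..d}. \<forall>l\<in>{1..d}. row_term d w L U x z i m \<le> row_term d w L U x z i l" for i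
    using ex_is_arg_min_if_finite[of "{1..d}" "row_term d w L U x z i"] assms
    unfolding is_arg_min_linorder by force
  then obtain m where
    "\<And>i. m i \<in> {1..d} \<and> (\<forall>l\<in>{1..d}. row_term d w L U x z i (m i) \<le> row_term d w L U x z i l)"
    by metis
  then have "restrict m {1..\<eta>} \<in> selections \<eta> d w L U x z"
    by (auto simp: mem_selections_iff mappings_def)
  then show ?thesis by blast
qed

text \<open>The entries of a mapping are chosen independently and the \<open>b\<close>-part is
  common to all mappings, so rowwise minima add up to the least right-hand side. That one is
  violated as soon as any is.\<close>

lemma most_violated_selection:
  assumes I: "I \<in> selections \<eta> d w L U x z"
    and ex: "\<exists>J\<in>mappings \<eta> d. violated \<eta> d w b L U x y z J"
  shows "most_violated \<eta> d w b L U x y z I"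
proof -
  have least: "family_rhs \<eta> d w b L U I x z \<le> family_rhs \<eta> d w b L U J x z"
    if "J \<in> mappings \<eta> d" for J
    using I PiE_mem[OF that[unfolded mappings_def]] unfolding family_rhs_row_term
    by (intro add_right_mono sum_mono) (simp add: mem_selections_iff)
  then show ?thesis
    using I ex by (force simp: most_violated_def violated_def mem_selections_iff)
qed

lemma threshold_minimises:
  fixes v \<zeta> :: "nat \<Rightarrow> real" and d :: nat and l u x t :: real
  defines "g \<equiv> \<lambda>t. t * x + (\<Sum>m=1..d. max ((v m - t) * l) ((v m - t) * u) * \<zeta> m)"
  assumes mono: "mono_on {1..d} v"
    and nonneg: "\<And>m. m \<in> {1..d} \<Longrightarrow> 0 \<le> \<zeta> m"
    and sum1: "(\<Sum>m=1..d. \<zeta> m) = 1"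
    and lu: "l \<le> u"
    and J: "J \<in> {1..d}"
    and below: "x + (u - l) * (\<Sum>m=1..<J. \<zeta> m) \<le> u"
    and above: "u \<le> x + (u - l) * (\<Sum>m=1..J. \<zeta> m)"
  shows "g (v J) \<le> g t"
proof -
  define A where "A = (\<Sum>m=1..<J. \<zeta> m)"
  define B where "B = (\<Sum>m=Suc J..d. \<zeta> m)"
  have parts: "{1..d} = {1..<J} \<union> {J} \<union> {Suc J..d}"
    using J by auto
  have split: "(\<Sum>m=1..d. h m) = (\<Sum>m=1..<J. h m) + h J + (\<Sum>m=Suc J..d. h m)"
    for h :: "nat \<Rightarrow> real"
    unfolding parts by (subst sum.union_disjoint, auto)+
  have AJ: "(\<Sum>m=1..J. \<zeta> m) = A + \<zeta> J"
    using J by (simp add: A_def atLeastLessThanSuc_atLeastAtMost[symmetric])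
  have total: "A + \<zeta> J + B = 1"
    using split[of \<zeta>] sum1 by (simp add: A_def B_def)
  have zJ: "0 \<le> \<zeta> J"
    using nonneg J by blast
  \<comment> \<open>After eliminating \<open>B\<close> these are \<open>above\<close> and
    \<open>below\<close>, respectively.\<close>
  have lo: "l * \<zeta> J \<le> x - l * A - u * B" and hi: "x - l * A - u * B \<le> u * \<zeta> J"
  proof -
    have B: "B = 1 - A - \<zeta> J" using total by simp
    show "l * \<zeta> J \<le> x - l * A - u * B" "x - l * A - u * B \<le> u * \<zeta> J"
      using below above unfolding AJ A_def[symmetric] B by (simp_all add: algebra_simps)
  qed
  \<comment> \<open>The mean condition forces \<open>r\<close> at position \<open>J\<close>. If
    \<open>\<zeta> J = 0\<close>, then \<open>lo\<close> and \<open>hi\<close> make the right side 0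
    and any point of the interval works, here \<open>l\<close>.\<close>
  obtain r where r: "l \<le> r" "r \<le> u" "r * \<zeta> J = x - l * A - u * B"
  proof (cases "\<zeta> J = 0")
    case True
    then show ?thesis using lo hi lu that[of l] by simp
  next
    case False
    then show ?thesis
      using lo hi zJ that[of "(x - l * A - u * B) / \<zeta> J"] by (simp add: field_simps)
  qed
  define s where "s m = (if m < J then l else if m = J then r else u)" for m
  have mean: "(\<Sum>m=1..d. s m * \<zeta> m) = x"
    unfolding split using r(3) by (simp add: s_def A_def B_def sum_distrib_left cong: sum.cong_simp)
  \<comment> \<open>The left side does not contain \<open>t\<close>, so the right sides at
    \<open>v J\<close> and at an arbitrary \<open>t\<close> agree.\<close>
  have dual: "(\<Sum>m=1..d. v m * s m * \<zeta> m) = t * x + (\<Sum>m=1..d. (v m - t) * s m * \<zeta> m)" for t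
    by (simp add: mean[symmetric] sum_distrib_left algebra_simps sum_subtractf)
  have "g (v J) = v J * x + (\<Sum>m=1..d. (v m - v J) * s m * \<zeta> m)"
  proof -
    \<comment> \<open>The sign of \<open>v m - v J\<close> decides which endpoint attains the
      maximum; at \<open>m = J\<close> the factor vanishes, so the value \<open>r\<close> does no
      harm.\<close>
    have "max ((v m - v J) * l) ((v m - v J) * u) = (v m - v J) * s m" if m: "m \<in> {1..d}" for m
    proof (cases "m < J")
      case True
      then have "v m \<le> v J" using mono_onD[OF mono m J] by simp
      then show ?thesis using True lu by (simp add: s_def max_absorb1 mult_left_mono_neg)
    next
      case False
      then have "v J \<le> v m" using mono_onD[OF mono J m] by simp
      then show ?thesis using False lu by (auto simp: s_def max_absorb2 mult_left_mono)
    qed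
    then show ?thesis by (simp add: g_def)
  qed
  also have "\<dots> = t * x + (\<Sum>m=1..d. (v m - t) * s m * \<zeta> m)"
    using dual by metis
  also have "\<dots> \<le> g t"
  proof -
    have "(v m - t) * s m \<le> max ((v m - t) * l) ((v m - t) * u)" for m
    proof (cases "t \<le> v m")
      case True
      then have "(v m - t) * s m \<le> (v m - t) * u"
        using r lu by (intro mult_left_mono) (auto simp: s_def)
      then show ?thesis by simp
    next
      case False
      then have "(v m - t) * s m \<le> (v m - t) * l"
        using r lu by (intro mult_left_mono_neg) (auto simp: s_def)
      then show ?thesis by simp
    qed
    then show ?thesis
      unfolding g_def using nonneg by (intro add_left_mono sum_mono mult_right_mono) auto
  qed
  finally show ?thesis .
qed

text \<open>A row sums over all columns, so relabelling them by \<open>p\<close> reduces to sorted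
  weights. The comparison covers every \<open>l\<close> because the sorted case allows any real
  \<open>t\<close>.\<close>

lemma threshold_row_term_le:
  assumes x: "x \<in> box \<eta> L U" and z: "z \<in> simplex d" and i: "i \<in> {1..\<eta>}"
    and bij: "bij_betw p {1..d} {1..d}" and mono: "mono_on {1..d} (\<lambda>j. w (p j) i)"
    and J: "J \<in> {1..d}"
    and below: "x i + (U i - L i) * (\<Sum>m=1..<J. z (p m)) \<le> U i"
    and above: "U i \<le> x i + (U i - L i) * (\<Sum>m=1..J. z (p m))"
  shows "row_term d w L U x z i (p J) \<le> row_term d w L U x z i l"
proof -
  have reindex: "(\<Sum>k=1..d. h k) = (\<Sum>m=1..d. h (p m))" for h :: "nat \<Rightarrow> real"
    using sum.reindex_bij_betw[OF bij, of h] by simp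
  have "0 \<le> z (p m)" if "m \<in> {1..d}" for m
    using z bij_betwE[OF bij] that unfolding simplex_def by blast
  moreover have "(\<Sum>m=1..d. z (p m)) = 1"
    using z reindex[of z] by (simp add: simplex_def)
  moreover have "L i \<le> U i"
    using x i by (force simp: box_def)
  moreover have "row_term d w L U x z i k = w k i * x i + (\<Sum>m=1..d.
      max ((w (p m) i - w k i) * L i) ((w (p m) i - w k i) * U i) * z (p m))" for k
    unfolding row_term_def by (subst reindex) (rule refl)
  ultimately show ?thesis
    using threshold_minimises[of d "\<lambda>j. w (p j) i" "\<lambda>m. z (p m)" "L i" "U i" J "x i" "w l i"]
      mono J below above by simp
qed


section \<open>Reasoning about timed executions\<close>

text \<open>Total correctness with a postcondition that also sees the step count, so that costs
  accumulate along \<open>Seq\<close>.\<close>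

definition runs :: "com \<Rightarrow> state \<Rightarrow> (nat \<Rightarrow> state \<Rightarrow> bool) \<Rightarrow> bool" where
  "runs c s Q \<longleftrightarrow> (\<exists>t s'. exec c s t s' \<and> Q t s')"

lemma runs_NSet:
  "Q (1 + ncost e) (s\<lparr>nreg := (nreg s)(v := nval e s)\<rparr>) \<Longrightarrow> runs (NSet v e) s Q"
  unfolding runs_def by (blast intro: exec.NSet)

lemma runs_NPut:
  "Q (1 + ncost j + ncost e) (s\<lparr>narr := (narr s)(a := (narr s a)(nval j s := nval e s))\<rparr>)
    \<Longrightarrow> runs (NPut a j e) s Q"
  unfolding runs_def by (blast intro: exec.NPut)

lemma runs_RSet:
  "Q (1 + rcost e) (s\<lparr>rreg := (rreg s)(v := rval e s)\<rparr>) \<Longrightarrow> runs (RSet v e) s Q"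
  unfolding runs_def by (blast intro: exec.RSet)

lemma runs_Seq:
  "runs c1 s (\<lambda>t1 s1. runs c2 s1 (\<lambda>t2. Q (t1 + t2))) \<Longrightarrow> runs (Seq c1 c2) s Q"
  unfolding runs_def by (blast intro: exec.Seq)

lemmas runs_straight = runs_NSet runs_NPut runs_RSet runs_Seq

lemma runs_mono: "runs c s Q \<Longrightarrow> (\<And>t s'. Q t s' \<Longrightarrow> R t s') \<Longrightarrow> runs c s R"
  unfolding runs_def by blast

text \<open>The variant \<open>f\<close> allows at most \<open>f s\<close> iterations; the
  additional unit in \<open>Suc (f s)\<close> pays for the final failing test.\<close>

lemma runs_While:
  fixes f :: "state \<Rightarrow> nat"
  assumes "P s"
    and step: "\<And>s. P s \<Longrightarrow> bval p s \<Longrightarrow> runs c s (\<lambda>t s'. t \<le> T \<and> P s' \<and> f s' < f s)"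
  shows "runs (While p c) s (\<lambda>t s'. t \<le> Suc (f s) * (1 + bcost p + T) \<and> P s' \<and> \<not> bval p s')"
  using \<open>P s\<close>
proof (induction "f s" arbitrary: s rule: less_induct)
  case less
  show ?case
  proof (cases "bval p s")
    case False
    then show ?thesis
      using less.prems exec.WhileFalse[OF False, of c] unfolding runs_def by fastforce
  next
    case True
    then obtain t1 s1 where 1: "exec c s t1 s1" "t1 \<le> T" "P s1" "f s1 < f s"
      using step[OF less.prems] unfolding runs_def by blast
    then obtain t2 s2 where 2: "exec (While p c) s1 t2 s2"
      "t2 \<le> Suc (f s1) * (1 + bcost p + T)" "P s2" "\<not> bval p s2"
      using less.hyps unfolding runs_def by blast
    have "t2 \<le> f s * (1 + bcost p + T)"
      using 2(2) mult_le_mono1[of "Suc (f s1)" "f s" "1 + bcost p + T"] 1(4) by linarith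
    then have "1 + bcost p + t1 + t2 \<le> Suc (f s) * (1 + bcost p + T)"
      using 1(2) by simp
    then show ?thesis
      using exec.WhileTrue[OF True 1(1) 2(1)] 2 unfolding runs_def by blast
  qed
qed


section \<open>The separation program\<close>

text \<open>
  The expression \<open>e\<close> computes the index of the \<open>j\<close>-th smallest weight of the current row from the
  registers \<open>j\<close> and \<open>r\<close>, where \<open>r = i * d\<close> is the row offset; register \<open>Z\<close> holds the prefix sum of \<open>z\<close>.
\<close>

definition scan :: "nexp \<Rightarrow> com" where
  "scan e =
     While
       (RLess
         (RAdd (RGet ''x'' (NReg ''i''))
           (RMul (RSub (RGet ''U'' (NReg ''i'')) (RGet ''L'' (NReg ''i''))) (RReg ''Z'')))
         (RGet ''U'' (NReg ''i'')))
       (Seq (NSet ''j'' (NAdd (NReg ''j'') (NConst 1)))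
            (RSet ''Z'' (RAdd (RReg ''Z'') (RGet ''z'' e))))"

definition process_row :: "nexp \<Rightarrow> com" where
  "process_row e =
     Seq (NSet ''j'' (NConst 1))
    (Seq (RSet ''Z'' (RGet ''z'' e))
    (Seq (scan e)
    (Seq (NPut ''I'' (NReg ''i'') e)
    (Seq (NSet ''i'' (NAdd (NReg ''i'') (NConst 1)))
         (NSet ''r'' (NAdd (NReg ''r'') (NReg ''d'')))))))"

text \<open>Naturals cannot be multiplied on the machine, so the row offset \<open>r\<close> is
  maintained by repeated addition of \<open>d\<close>.\<close>

definition separate :: "nexp \<Rightarrow> com" where
  "separate e =
     Seq (NSet ''i'' (NConst 1))
    (Seq (NSet ''r'' (NReg ''d''))
         (While (BNot (NLess (NReg ''eta'') (NReg ''i''))) (process_row e)))"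

text \<open>One analysis serves both input formats: \<open>e\<close> abstracts the lookup of the
  \<open>j\<close>-th smallest weight. Fixing the array \<open>''sigma''\<close> as \<open>N\<close>
  keeps \<open>nval_index\<close> applicable throughout the run.\<close>

locale separation_input =
  fixes \<eta> d :: nat and w :: "nat \<Rightarrow> nat \<Rightarrow> real" and b L U x :: "nat \<Rightarrow> real" and y :: real
    and z :: "nat \<Rightarrow> real" and \<sigma> :: "nat \<Rightarrow> nat \<Rightarrow> nat" and N :: "nat \<Rightarrow> nat" and e :: nexp
  assumes eta_pos: "1 \<le> \<eta>"
    and x_box: "x \<in> box \<eta> L U"
    and z_simplex: "z \<in> simplex d"
    and sigma_bij: "i \<in> {1..\<eta>} \<Longrightarrow> bij_betw (\<sigma> i) {1..d} {1..d}"
    and sigma_mono: "i \<in> {1..\<eta>} \<Longrightarrow> mono_on {1..d} (\<lambda>j. w (\<sigma> i j) i)"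
    and nval_index:
      "narr s ''sigma'' = N \<Longrightarrow> nreg s ''r'' = i * d \<Longrightarrow> nreg s ''j'' = j
        \<Longrightarrow> i \<in> {1..\<eta>} \<Longrightarrow> j \<in> {1..d} \<Longrightarrow> nval e s = \<sigma> i j"
begin

section \<open>Loop invariants, correctness and step counts\<close>

definition row_state :: "nat \<Rightarrow> state \<Rightarrow> bool" where
  "row_state i s \<longleftrightarrow> encodes \<eta> d w b L U x y z s \<and> narr s ''sigma'' = N \<and>
     nreg s ''i'' = i \<and> nreg s ''r'' = i * d"

text \<open>The last conjunct is the lower threshold condition: at \<open>j = 1\<close> it reads
  \<open>x \<le> U\<close>, and later it is inherited from the guard that let the scan
  advance.\<close>

definition scan_inv :: "nat \<Rightarrow> (nat \<Rightarrow> nat) \<Rightarrow> state \<Rightarrow> bool" where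
  "scan_inv i M s \<longleftrightarrow> row_state i s \<and> narr s ''I'' = M \<and> nreg s ''j'' \<in> {1..d} \<and>
     rreg s ''Z'' = (\<Sum>m=1..nreg s ''j''. z (\<sigma> i m)) \<and>
     x i + (U i - L i) * (\<Sum>m=1..<nreg s ''j''. z (\<sigma> i m)) \<le> U i"

definition row_correct :: "(nat \<Rightarrow> nat) \<Rightarrow> nat \<Rightarrow> bool" where
  "row_correct M i \<longleftrightarrow> M i \<in> {1..d} \<and>
     (\<forall>l\<in>{1..d}. row_term d w L U x z i (M i) \<le> row_term d w L U x z i l)"

lemma sigma_range: "i \<in> {1..\<eta>} \<Longrightarrow> j \<in> {1..d} \<Longrightarrow> \<sigma> i j \<in> {1..d}"
  using bij_betwE[OF sigma_bij] by blast

lemma read_z: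
  "encodes \<eta> d w b L U x y z s \<Longrightarrow> i \<in> {1..\<eta>} \<Longrightarrow> j \<in> {1..d} \<Longrightarrow> rarr s ''z'' (\<sigma> i j) = z (\<sigma> i j)"
  using sigma_range unfolding encodes_def by blast

lemma runs_scan:
  assumes i: "i \<in> {1..\<eta>}" and inv: "scan_inv i M s" and j: "nreg s ''j'' = 1"
  shows "runs (scan e) s (\<lambda>t s'. t \<le> d * (22 + ncost e) \<and> scan_inv i M s' \<and>
           U i \<le> x i + (U i - L i) * (\<Sum>m=1..nreg s' ''j''. z (\<sigma> i m)))"
proof -
  have cells: "rarr s ''L'' i = L i" "rarr s ''U'' i = U i" "rarr s ''x'' i = x i" "nreg s ''i'' = i"
    "rreg s ''Z'' = (\<Sum>m=1..nreg s ''j''. z (\<sigma> i m))"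
    if "scan_inv i M s" for s
    using that i unfolding scan_inv_def row_state_def encodes_def by auto
  have step: "runs (Seq (NSet ''j'' (NAdd (NReg ''j'') (NConst 1)))
                (RSet ''Z'' (RAdd (RReg ''Z'') (RGet ''z'' e)))) s
         (\<lambda>t s'. t \<le> 8 + ncost e \<and> scan_inv i M s' \<and> d - nreg s' ''j'' < d - nreg s ''j'')"
    if inv: "scan_inv i M s"
      and guard: "x i + (U i - L i) * (\<Sum>m=1..nreg s ''j''. z (\<sigma> i m)) < U i" for s
  proof -
    let ?j = "nreg s ''j''" and ?s = "s\<lparr>nreg := (nreg s)(''j'' := nreg s ''j'' + 1)\<rparr>"
    have "(\<Sum>m=1..d. z (\<sigma> i m)) = 1"
      using sum.reindex_bij_betw[OF sigma_bij[OF i], of z] z_simplex by (simp add: simplex_def)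
    moreover have "L i \<le> x i"
      using x_box i by (auto simp: box_def)
    \<comment> \<open>the last prefix sum is 1, and there the guard would read \<open>x < L\<close>\<close>
    ultimately have "?j \<noteq> d"
      using guard by auto
    then have lt: "?j < d"
      using inv by (auto simp: scan_inv_def)
    have row: "row_state i ?s"
      using inv by (simp add: scan_inv_def row_state_def encodes_def)
    have "nval e ?s = \<sigma> i (?j + 1)"
      by (rule nval_index[OF _ _ _ i]) (use row lt in \<open>auto simp: row_state_def\<close>)
    then have val: "rarr s ''z'' (nval e ?s) = z (\<sigma> i (?j + 1))"
      using read_z[of ?s i "?j + 1"] i row lt by (simp add: row_state_def)
    show ?thesis
      apply (intro runs_straight)
      using inv lt val guard
      apply (simp add: scan_inv_def row_state_def encodes_def atLeastLessThanSuc_atLeastAtMost)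
      done
  qed
  \<comment> \<open>The guard costs 13 and the body \<open>8 + ncost e\<close>; starting at
    \<open>j = 1\<close> makes the first factor equal to \<open>d\<close>.\<close>
  have "runs (scan e) s (\<lambda>t s'. t \<le> Suc (d - nreg s ''j'') * (1 + 13 + (8 + ncost e)) \<and>
           scan_inv i M s' \<and> \<not> x i + (U i - L i) * (\<Sum>m=1..nreg s' ''j''. z (\<sigma> i m)) < U i)"
    unfolding scan_def
    apply (rule runs_mono[OF runs_While[where P = "scan_inv i M" and T = "8 + ncost e"
          and f = "\<lambda>s. d - nreg s ''j''", OF inv]])
    subgoal for s by (rule step) (use cells[of s] in auto)
    subgoal for t s' using cells[of s'] by (auto simp: algebra_simps)
    done
  then show ?thesis
    using simplex_dim_pos[OF z_simplex] j by (auto elim!: runs_mono simp: algebra_simps)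
qed

lemma runs_process_row:
  assumes i: "i \<in> {1..\<eta>}" and row: "row_state i s"
    and earlier: "\<And>k. k \<in> {1..<i} \<Longrightarrow> row_correct (narr s ''I'') k"
  shows "runs (process_row e) s (\<lambda>t s'. t \<le> d * (36 + 3 * ncost e) \<and> row_state (Suc i) s' \<and>
           (\<forall>k\<in>{1..<Suc i}. row_correct (narr s' ''I'') k))"
proof -
  have d: "1 \<le> d"
    using simplex_dim_pos[OF z_simplex] .
  let ?M = "narr s ''I''" and ?s = "s\<lparr>nreg := (nreg s)(''j'' := 1)\<rparr>"
  let ?s1 = "?s\<lparr>rreg := (rreg ?s)(''Z'' := rval (RGet ''z'' e) ?s)\<rparr>"
  have row': "row_state i ?s"
    using row by (simp add: row_state_def encodes_def)
  have "nval e ?s = \<sigma> i 1"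
    by (rule nval_index[OF _ _ _ i]) (use row' d in \<open>auto simp: row_state_def\<close>)
  then have "rval (RGet ''z'' e) ?s = z (\<sigma> i 1)"
    using read_z[of ?s i 1] i row' d by (simp add: row_state_def)
  then have inv: "scan_inv i ?M ?s1"
    using row d x_box i by (auto simp: scan_inv_def row_state_def encodes_def box_def)
  have finish: "runs (Seq (NPut ''I'' (NReg ''i'') e) (Seq (NSet ''i'' (NAdd (NReg ''i'') (NConst 1)))
         (NSet ''r'' (NAdd (NReg ''r'') (NReg ''d''))))) s'
      (\<lambda>t s''. t \<le> 10 + ncost e \<and> row_state (Suc i) s'' \<and>
           (\<forall>k\<in>{1..<Suc i}. row_correct (narr s'' ''I'') k))"
    if inv: "scan_inv i ?M s'"
      and stop: "U i \<le> x i + (U i - L i) * (\<Sum>m=1..nreg s' ''j''. z (\<sigma> i m))" for s'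
  proof -
    let ?j = "nreg s' ''j''"
    have j: "?j \<in> {1..d}"
      using inv by (simp add: scan_inv_def)
    have val: "nval e s' = \<sigma> i ?j"
      by (rule nval_index[OF _ _ _ i j]) (use inv in \<open>auto simp: scan_inv_def row_state_def\<close>)
    have below: "x i + (U i - L i) * (\<Sum>m=1..<?j. z (\<sigma> i m)) \<le> U i"
      using inv by (simp add: scan_inv_def)
    have "row_term d w L U x z i (\<sigma> i ?j) \<le> row_term d w L U x z i l" for l
      using x_box z_simplex i sigma_bij[OF i] sigma_mono[OF i] j below stop
      by (rule threshold_row_term_le[where p = "\<sigma> i"])
    then have "row_correct (?M(i := \<sigma> i ?j)) k" if "k \<in> {1..<Suc i}" for k
      using earlier[of k] that sigma_range[OF i j] by (auto simp: row_correct_def less_Suc_eq)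
    then show ?thesis
      using inv by (intro runs_straight) (simp add: val scan_inv_def row_state_def encodes_def)
  qed
  \<comment> \<open>Outside the scan a row costs \<open>14 + 2 * ncost e\<close>, which
    \<open>1 \<le> d\<close> absorbs into a multiple of \<open>d\<close>.\<close>
  have bound: "n \<le> d * (36 + 3 * ncost e)"
    if "n \<le> 14 + 2 * ncost e + d * (22 + ncost e)" for n
    using that mult_le_mono1[OF d, of "14 + 2 * ncost e"] by (simp add: algebra_simps)
  show ?thesis
    unfolding process_row_def
    apply (intro runs_Seq runs_NSet runs_RSet)
    apply (simp only: nval.simps)
    apply (rule runs_mono[OF runs_scan[OF i inv]])
     apply simp
    apply (elim conjE)
    apply (rule runs_mono[OF finish], assumption+)
    apply (auto intro!: bound)
    done
qed

lemma runs_separate: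
  assumes s: "encodes \<eta> d w b L U x y z s" "narr s ''sigma'' = N"
  shows "\<exists>t s'. exec (separate e) s t s' \<and> t \<le> (86 + 6 * ncost e) * (\<eta> * d) \<and>
           output_mapping \<eta> s' \<in> selections \<eta> d w L U x z"
proof -
  have d: "1 \<le> d"
    using simplex_dim_pos[OF z_simplex] .
  let ?T = "d * (36 + 3 * ncost e)"
  let ?g = "BNot (NLess (NReg ''eta'') (NReg ''i''))"
  \<comment> \<open>The counter names the next row to process, hence it reaches
    \<open>Suc \<eta>\<close> on exit.\<close>
  let ?P = "\<lambda>s. nreg s ''i'' \<in> {1..Suc \<eta>} \<and> row_state (nreg s ''i'') s \<and>
      (\<forall>k\<in>{1..<nreg s ''i''}. row_correct (narr s ''I'') k)"
  let ?s = "s\<lparr>nreg := (nreg s)(''i'' := nval (NConst 1) s)\<rparr>"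
  let ?s' = "?s\<lparr>nreg := (nreg ?s)(''r'' := nval (NReg ''d'') ?s)\<rparr>"
  have init: "?P ?s'"
    using s by (simp add: row_state_def encodes_def)
  have step: "runs (process_row e) s
      (\<lambda>t s'. t \<le> ?T \<and> ?P s' \<and> Suc \<eta> - nreg s' ''i'' < Suc \<eta> - nreg s ''i'')"
    if P: "?P s" and guard: "bval ?g s" for s
  proof -
    have i: "nreg s ''i'' \<in> {1..\<eta>}"
      using P guard by (auto simp: row_state_def encodes_def)
    show ?thesis
      by (rule runs_mono[OF runs_process_row[OF i]]) (use P i in \<open>auto simp: row_state_def\<close>)
  qed
  have exit: "output_mapping \<eta> s' \<in> selections \<eta> d w L U x z"
    if P: "?P s'" and guard: "\<not> bval ?g s'" for s'
  proof -
    have "nreg s' ''eta'' = \<eta>"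
      using P by (simp add: row_state_def encodes_def)
    then have "row_correct (narr s' ''I'') k" if "k \<in> {1..\<eta>}" for k
      using P guard that by auto
    then show ?thesis
      by (auto simp: mem_selections_iff mappings_def output_mapping_def row_correct_def)
  qed
  have loop: "runs (While ?g (process_row e)) ?s'
      (\<lambda>t s'. t \<le> Suc \<eta> * (5 + ?T) \<and> output_mapping \<eta> s' \<in> selections \<eta> d w L U x z)"
  proof (rule runs_mono[OF runs_While[where P = ?P and f = "\<lambda>s. Suc \<eta> - nreg s ''i''" and T = ?T]])
    show "?P ?s'" by (fact init)
  next
    fix t s'
    assume *: "t \<le> Suc (Suc \<eta> - nreg ?s' ''i'') * (1 + bcost ?g + ?T) \<and> ?P s' \<and> \<not> bval ?g s'"
    then have "t \<le> Suc \<eta> * (5 + ?T)"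
      by (simp add: algebra_simps)
    with * show "t \<le> Suc \<eta> * (5 + ?T) \<and> output_mapping \<eta> s' \<in> selections \<eta> d w L U x z"
      using exit by blast
  qed (use step in blast)
  \<comment> \<open>The two initial assignments cost 4 and each outer test 5. With
    \<open>Suc \<eta> \<le> 2 * \<eta>\<close> the constants combine to
    \<open>86 = 4 + 2 * 41\<close>.\<close>
  have bound: "4 + Suc \<eta> * (5 + ?T) \<le> (86 + 6 * ncost e) * (\<eta> * d)"
  proof -
    have "5 + ?T \<le> d * (41 + 3 * ncost e)"
      using d by (simp add: algebra_simps)
    then have loop_cost: "Suc \<eta> * (5 + ?T) \<le> (2 * \<eta>) * (d * (41 + 3 * ncost e))"
      using eta_pos by (intro mult_le_mono) auto
    have "4 \<le> 4 * (\<eta> * d)"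
      using eta_pos d by simp
    from add_mono[OF this loop_cost] show ?thesis
      by (rule order_trans) (simp add: algebra_simps)
  qed
  have "runs (separate e) s (\<lambda>t s'. t \<le> (86 + 6 * ncost e) * (\<eta> * d) \<and>
      output_mapping \<eta> s' \<in> selections \<eta> d w L U x z)"
    unfolding separate_def
  proof (intro runs_Seq runs_NSet, rule runs_mono[OF loop])
    fix t s'
    assume *: "t \<le> Suc \<eta> * (5 + ?T) \<and> output_mapping \<eta> s' \<in> selections \<eta> d w L U x z"
    have "1 + ncost (NConst 1) + (1 + ncost (NReg ''d'') + t) \<le> 4 + Suc \<eta> * (5 + ?T)"
      using * by simp
    with bound * show "1 + ncost (NConst 1) + (1 + ncost (NReg ''d'') + t)
        \<le> (86 + 6 * ncost e) * (\<eta> * d) \<and> output_mapping \<eta> s' \<in> selections \<eta> d w L U x z"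
      by (blast intro: order_trans)
  qed
  then show ?thesis
    unfolding runs_def by blast
qed

end

section \<open>The two input formats: sorted weights and given sorting permutations\<close>

lemma separate_sorted:
  assumes "1 \<le> \<eta>" "x \<in> box \<eta> L U" "z \<in> simplex d"
    and "\<forall>i\<in>{1..\<eta>}. mono_on {1..d} (\<lambda>k. w k i)" "encodes \<eta> d w b L U x y z s"
  shows "\<exists>t s'. exec (separate (NReg ''j'')) s t s' \<and> t \<le> 92 * (\<eta> * d) \<and>
           output_mapping \<eta> s' \<in> selections \<eta> d w L U x z"
proof -
  \<comment> \<open>The order is the identity and reading \<open>j\<close> costs 1, whence
    \<open>92 = 86 + 6 * 1\<close>.\<close>
  interpret separation_input \<eta> d w b L U x y z "\<lambda>_ j. j" "narr s ''sigma''" "NReg ''j''"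
    using assms by unfold_locales (auto simp: bij_betw_def)
  show ?thesis
    using runs_separate[OF assms(5)] by simp
qed

lemma separate_ordered:
  assumes "1 \<le> \<eta>" "x \<in> box \<eta> L U" "z \<in> simplex d"
    and "\<forall>i\<in>{1..\<eta>}. bij_betw (\<sigma> i) {1..d} {1..d} \<and> mono_on {1..d} (\<lambda>j. w (\<sigma> i j) i)"
    and "encodes \<eta> d w b L U x y z s" "encodes_orders \<eta> d \<sigma> s"
  shows "\<exists>t s'. exec (separate (NGet ''sigma'' (NAdd (NReg ''r'') (NReg ''j'')))) s t s' \<and>
           t \<le> 110 * (\<eta> * d) \<and> output_mapping \<eta> s' \<in> selections \<eta> d w L U x z"
proof -
  \<comment> \<open>The table lookup at \<open>r + j\<close> costs 4, whence
    \<open>110 = 86 + 6 * 4\<close>.\<close>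
  interpret separation_input \<eta> d w b L U x y z \<sigma> "narr s ''sigma''"
    "NGet ''sigma'' (NAdd (NReg ''r'') (NReg ''j''))"
    using assms by unfold_locales (auto simp: encodes_orders_def)
  show ?thesis
    using runs_separate[OF assms(5)] by simp
qed

text \<open>Sortedness is treated in both readings: monotone weights in each row, or a sorting
  permutation per row supplied as input. Program and constant are fixed before the dimensions, so
  the bound is uniform.\<close>

theorem proposition11:
  shows
    "(\<forall>(\<eta>::nat) (d::nat) (w::nat \<Rightarrow> nat \<Rightarrow> real) b L U x y z.
       x \<in> box \<eta> L U \<and> z \<in> simplex d \<longrightarrow>
         selections \<eta> d w L U x z \<noteq> {} \<and>
         ((\<exists>I\<in>mappings \<eta> d. violated \<eta> d w b L U x y z I) \<longrightarrow>
            (\<forall>I\<in>selections \<eta> d w L U x z. most_violated \<eta> d w b L U x y z I)))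
     \<and>
     (\<exists>(c::com) (C::nat). \<forall>(\<eta>::nat) (d::nat) (w::nat \<Rightarrow> nat \<Rightarrow> real) b L U x y z s.
       1 \<le> \<eta> \<and> x \<in> box \<eta> L U \<and> z \<in> simplex d \<and>
       (\<forall>i\<in>{1..\<eta>}. mono_on {1..d} (\<lambda>k. w k i)) \<and>
       encodes \<eta> d w b L U x y z s \<longrightarrow>
         (\<exists>t s'. exec c s t s' \<and> t \<le> C * (\<eta> * d) \<and>
                 output_mapping \<eta> s' \<in> selections \<eta> d w L U x z))
     \<and>
     (\<exists>(c::com) (C::nat). \<forall>(\<eta>::nat) (d::nat) (w::nat \<Rightarrow> nat \<Rightarrow> real) b L U x y z \<sigma> s.
       1 \<le> \<eta> \<and> x \<in> box \<eta> L U \<and> z \<in> simplex d \<and>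
       (\<forall>i\<in>{1..\<eta>}. bij_betw (\<sigma> i) {1..d} {1..d} \<and> mono_on {1..d} (\<lambda>j. w (\<sigma> i j) i)) \<and>
       encodes \<eta> d w b L U x y z s \<and> encodes_orders \<eta> d \<sigma> s \<longrightarrow>
         (\<exists>t s'. exec c s t s' \<and> t \<le> C * (\<eta> * d) \<and>
                 output_mapping \<eta> s' \<in> selections \<eta> d w L U x z))"
proof (intro conjI, goal_cases)
  case 1
  show ?case
    using selections_nonempty simplex_dim_pos most_violated_selection by blast
next
  case 2
  show ?case
    by (rule exI[of _ "separate (NReg ''j'')"], rule exI[of _ 92])
      (use separate_sorted in blast)
next
  case 3
  show ?case
    by (rule exI[of _ "separate (NGet ''sigma'' (NAdd (NReg ''r'') (NReg ''j'')))"],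
        rule exI[of _ 110]) (use separate_ordered in blast)
qed

end
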